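(* Let $x,z$ be formal variables and define rational functions $G_n(w)$ for $n\ge1$ by $G_1(w)=\frac1w$ and, for $n\ge2$, $$G_n(w)=\sum_{k=1}^{n-1}\frac{G_k(w)\,G_{n-k}(w+kz)}{w+(n-1)x}.$$ For integers $1\le k<n$ define $F_{k,n}(w)$ by $F_{1,n}(w)=G_n(w)$ and, for $k\ge2$, $$F_{k,n}(w)=\sum_{i=1}^{n-k-1}\frac{G_{n-k-i}(w+(k+i)z)\,F_{k,k+i}(w)}{w+(n-1)x}+\sum_{i=1}^{k-1}\frac{(w+iz)\,G_i(w+x)\,F_{k-i,n-i}(w+iz)}{w\,(w+(n-1)x)}.$$ Then for each $n\ge2$, $$F_{n-1,n}(w)=\frac{G_{n-1}(w+x)}{w\,(w+(n-1)z)}.$$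
   Context: All functions are rational functions in $w,x,z$, with $x$ and $z$ treated as constant formal variables and $w$ as the argument. *)

theory Defs
  imports "HOL-Computational_Algebra.Computational_Algebra"
begin

text \<open>
  Rational functions in \<open>x\<close>, \<open>z\<close>, \<open>w\<close> over a field \<open>'k\<close> are elements of
  \<open>Frac('k[x][z][w])\<close>: the innermost polynomial layer is in \<open>x\<close>, the middle one in \<open>z\<close>
  and the outermost one in the argument \<open>w\<close>.
\<close>

type_synonym 'k ratfun = "'k poly poly poly fract"

text \<open>\<open>xc\<close> and \<open>zc\<close> are \<open>x\<close> and \<open>z\<close> as elements of the coefficient ring \<open>'k[x][z]\<close>.\<close>

definition xc :: "'k::field_char_0 poly poly" where
  "xc = [:[:0, 1:]:]"

definition zc :: "'k::field_char_0 poly poly" where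
  "zc = [:0, 1:]"

definition wvar :: "'k::field_char_0 ratfun" where
  "wvar = to_fract [:0, 1:]"

definition xvar :: "'k::field_char_0 ratfun" where
  "xvar = to_fract [:xc:]"

definition zvar :: "'k::field_char_0 ratfun" where
  "zvar = to_fract [:zc:]"

text \<open>
  \<open>shift c f\<close> is \<open>f(w + c)\<close>: the substitution \<open>w \<mapsto> w + c\<close> in numerator and denominator,
  for \<open>c\<close> in the coefficient ring.
\<close>

definition shift :: "'r::idom \<Rightarrow> 'r poly fract \<Rightarrow> 'r poly fract" where
  "shift c f = (THE g. \<exists>p q. q \<noteq> 0 \<and> f = Fract p q
                         \<and> g = Fract (p \<circ>\<^sub>p [:c, 1:]) (q \<circ>\<^sub>p [:c, 1:]))"

lemma shift_Fract:
  fixes p q :: "'r::idom poly"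
  assumes "q \<noteq> 0"
  shows "shift c (Fract p q) = Fract (p \<circ>\<^sub>p [:c, 1:]) (q \<circ>\<^sub>p [:c, 1:])"
  unfolding shift_def
proof (rule the_equality)
  show "\<exists>p' q'. q' \<noteq> 0 \<and> Fract p q = Fract p' q'
          \<and> Fract (p \<circ>\<^sub>p [:c, 1:]) (q \<circ>\<^sub>p [:c, 1:]) = Fract (p' \<circ>\<^sub>p [:c, 1:]) (q' \<circ>\<^sub>p [:c, 1:])"
    using assms by blast
next
  fix g
  assume "\<exists>p' q'. q' \<noteq> 0 \<and> Fract p q = Fract p' q'
            \<and> g = Fract (p' \<circ>\<^sub>p [:c, 1:]) (q' \<circ>\<^sub>p [:c, 1:])"
  then obtain p' q' where q': "q' \<noteq> 0" and eq: "Fract p q = Fract p' q'"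
    and g: "g = Fract (p' \<circ>\<^sub>p [:c, 1:]) (q' \<circ>\<^sub>p [:c, 1:])"
    by blast
  have nz: "r \<circ>\<^sub>p [:c, 1:] \<noteq> 0" if "r \<noteq> 0" for r :: "'r poly"
    using that pcompose_eq_0[of r "[:c, 1:]"] by auto
  have "p * q' = p' * q"
    using eq assms q' by (simp add: eq_fract)
  then have "(p * q') \<circ>\<^sub>p [:c, 1:] = (p' * q) \<circ>\<^sub>p [:c, 1:]"
    by simp
  then show "g = Fract (p \<circ>\<^sub>p [:c, 1:]) (q \<circ>\<^sub>p [:c, 1:])"
    using g nz assms q' by (simp add: eq_fract pcompose_mult)
qed

lemma shift_wvar: "shift c wvar = wvar + to_fract [:c:]"
  by (simp add: wvar_def to_fract_def shift_Fract pcompose_pCons one_pCons)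

lemma shift_xvar: "shift c xvar = xvar" and shift_zvar: "shift c zvar = zvar"
  by (simp_all add: xvar_def zvar_def to_fract_def shift_Fract pcompose_1)

text \<open>The value at the unused index \<open>n = 0\<close> is junk.\<close>

function G :: "nat \<Rightarrow> 'k::field_char_0 ratfun" where
  "G n = (if n = 0 then 0
          else if n = 1 then 1 / wvar
          else \<Sum>k = 1..n - 1.
                 G k * shift (of_nat k * zc) (G (n - k)) / (wvar + of_nat (n - 1) * xvar))"
  by pat_completeness auto
termination by (relation "measure id") auto

declare G.simps [simp del]

text \<open>
  The value outside \<open>1 \<le> k < n\<close> is junk; the recursion never leaves this range, and within it
  all subtractions on \<^typ>\<open>nat\<close> are exact.
\<close>

function F :: "nat \<Rightarrow> nat \<Rightarrow> 'k::field_char_0 ratfun" where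
  "F k n = (if k = 0 \<or> n \<le> k then 0
            else if k = 1 then G n
            else (\<Sum>i = 1..n - k - 1.
                    shift (of_nat (k + i) * zc) (G (n - k - i)) * F k (k + i)
                      / (wvar + of_nat (n - 1) * xvar))
               + (\<Sum>i = 1..k - 1.
                    (wvar + of_nat i * zvar) * shift xc (G i)
                      * shift (of_nat i * zc) (F (k - i) (n - i))
                      / (wvar * (wvar + of_nat (n - 1) * xvar))))"
  by pat_completeness auto
termination by (relation "measure snd") auto

declare F.simps [simp del]

end

theory Submission
  imports Defs
begin

text \<open>
  On the diagonal \<open>k = n - 1\<close> the first sum of the recursion for \<open>F\<close> is empty. By induction the
  summands of the second one are
  \<open>G\<^sub>i(w + x) G\<^sub>n\<^sub>-\<^sub>1\<^sub>-\<^sub>i(w + x + iz) / (w (w + (n-1)x) (w + (n-1)z))\<close>, because the factor \<open>w + iz\<close>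
  cancels, and their sum is the recursion for \<open>G\<^sub>n\<^sub>-\<^sub>1\<close> evaluated at \<open>w + x\<close>.
\<close>

text \<open>The inner polynomial \<open>[:c, 1:]\<close> has positive degree. Hence shifted
  denominators stay nonzero, so fractions can be added after a shift or shifted again.\<close>

lemma pcompose_linear_eq_0_iff:
  fixes p :: "'r::idom poly"
  shows "p \<circ>\<^sub>p [:c, 1:] = 0 \<longleftrightarrow> p = 0"
  using pcompose_eq_0[of p "[:c, 1:]"] by auto

text \<open>First of the facts making \<open>shift c\<close> a field endomorphism, so that it can be
  pushed through both recursions.\<close>

lemma shift_0: "shift c 0 = 0"
  by (simp add: Zero_fract_def shift_Fract eq_fract)

lemma shift_1: "shift c 1 = 1"
  by (simp add: One_fract_def shift_Fract pcompose_1)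

lemma shift_add: "shift c (f + g) = shift c f + shift c g"
  by (cases f, cases g)
    (simp add: shift_Fract pcompose_add pcompose_mult pcompose_linear_eq_0_iff)

lemma shift_mult: "shift c (f * g) = shift c f * shift c g"
  by (cases f, cases g) (simp add: shift_Fract pcompose_mult)

lemma shift_inverse: "shift c (inverse f) = inverse (shift c f)"
proof (cases f)
  case (Fract p q)
  then show ?thesis
    by (cases "p = 0") (simp_all add: shift_Fract shift_0 fract_collapse)
qed

lemma shift_divide: "shift c (f / g) = shift c f / shift c g"
  by (simp add: divide_inverse shift_mult shift_inverse)

lemma shift_sum: "shift c (sum f A) = (\<Sum>i\<in>A. shift c (f i))"
  by (induction A rule: infinite_finite_induct) (simp_all add: shift_0 shift_add)

lemma shift_of_nat: "shift c (of_nat n) = of_nat n"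
  by (induction n) (simp_all add: shift_0 shift_1 shift_add)

text \<open>As \<open>c + d = d + c\<close>, shifts commute. This is how the shift by
  \<open>xc\<close> is moved outside the shift by \<open>of_nat i * zc\<close>.\<close>

lemma shift_shift: "shift c (shift d f) = shift (c + d) f"
proof (cases f)
  case (Fract p q)
  have "[:d, 1:] \<circ>\<^sub>p [:c, 1:] = [:c + d, 1:]"
    by (simp add: pcompose_pCons add.commute)
  then show ?thesis
    using Fract
    by (simp add: shift_Fract pcompose_linear_eq_0_iff flip: pcompose_assoc)
qed

lemma shift_xc_wvar: "shift xc wvar = wvar + xvar"
  by (simp add: shift_wvar xvar_def)

lemma to_fract_of_nat_zc: "to_fract [:of_nat i * zc:] = (of_nat i * zvar :: 'k::field_char_0 ratfun)"
proof (induction i)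
  case 0
  show ?case
    by simp
next
  case (Suc i)
  have "to_fract [:of_nat (Suc i) * zc:] = to_fract ([:zc:] + [:of_nat i * (zc :: 'k poly poly):])"
    by (simp add: distrib_right)
  also have "\<dots> = zvar + of_nat i * zvar"
    by (simp only: to_fract_add Suc zvar_def)
  finally show ?case
    by (simp add: distrib_right)
qed

lemma shift_zc_wvar: "shift (of_nat i * zc) wvar = wvar + of_nat i * zvar"
  by (simp add: shift_wvar to_fract_of_nat_zc)

text \<open>As a polynomial in w this has leading coefficient 1. It justifies cancelling w + iz in
  the summands.\<close>

lemma wvar_plus_zvar_nonzero: "wvar + of_nat i * zvar \<noteq> (0 :: 'k::field_char_0 ratfun)"
proof -
  have "wvar + of_nat i * zvar = to_fract ([:0, 1:] + [:of_nat i * (zc :: 'k poly poly):])"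
    by (simp only: wvar_def to_fract_of_nat_zc to_fract_add)
  then show ?thesis
    by simp
qed

theorem theorem2p2:
  fixes n :: nat
  assumes "n \<ge> 2"
  shows "(F (n - 1) n :: 'k::field_char_0 ratfun)
           = shift xc (G (n - 1)) / (wvar * (wvar + of_nat (n - 1) * zvar))"
  using assms
proof (induction n rule: less_induct)
  case (less n)
  show ?case
  proof (cases "n = 2")
    case True
    have G1: "G 1 = (1 / wvar :: 'k ratfun)"
      by (simp add: G.simps)
    \<comment> \<open>Here \<open>F\<close> falls under its clause \<open>k = 1\<close> and the sum
      for \<open>G 2\<close> has one term; both sides equal 1 / (w (w + x) (w + z)).\<close>
    have "F 1 2 = (G 2 :: 'k ratfun)"
      by (simp add: F.simps)
    also have "\<dots> = G 1 * shift (of_nat 1 * zc) (G 1) / (wvar + of_nat 1 * xvar)"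
      by (subst G.simps) simp
    also have "\<dots> = shift xc (G 1) / (wvar * (wvar + of_nat 1 * zvar))"
      unfolding G1 by (simp only: shift_divide shift_1 shift_zc_wvar shift_xc_wvar) simp
    finally show ?thesis
      using True by simp
  next
    case False
    then obtain m where n: "n = Suc m" and m: "m \<ge> 2"
      using less.prems by (cases n) auto
    let ?d = "wvar * (wvar + of_nat m * xvar) * (wvar + of_nat m * zvar) :: 'k ratfun"
    have summand: "(wvar + of_nat i * zvar) * shift xc (G i) * shift (of_nat i * zc) (F (m - i) (n - i))
          / (wvar * (wvar + of_nat m * xvar))
        = shift xc (G i) * shift xc (shift (of_nat i * zc) (G (m - i))) / ?d"
      if i: "i \<in> {1..m - 1}" for i
    proof -
      \<comment> \<open>The pair is again diagonal, since n - i - 1 = m - i, and i \<le> m - 1 gives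
        n - i \<ge> 2.\<close>
      have "F (m - i) (n - i)
          = shift xc (G (m - i)) / (wvar * (wvar + of_nat (m - i) * zvar) :: 'k ratfun)"
        using less.IH[of "n - i"] i n m by (auto simp del: of_nat_diff)
      \<comment> \<open>The shift raises m - i to m, so this factor of the denominator no longer
        depends on i.\<close>
      moreover have "shift (of_nat i * zc) (wvar + of_nat (m - i) * zvar)
          = (wvar + of_nat m * zvar :: 'k ratfun)"
      proof -
        have "of_nat m = (of_nat i + of_nat (m - i) :: 'k ratfun)"
          using i by (metis atLeastAtMost_iff diff_le_self le_add_diff_inverse le_trans of_nat_add)
        then show ?thesis
          by (simp only: shift_add shift_mult shift_of_nat shift_zvar shift_zc_wvar distrib_right
              add.assoc)
      qed
      ultimately have "shift (of_nat i * zc) (F (m - i) (n - i))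
          = shift xc (shift (of_nat i * zc) (G (m - i)))
            / ((wvar + of_nat i * zvar) * (wvar + of_nat m * zvar) :: 'k ratfun)"
        by (simp add: shift_divide shift_mult shift_zc_wvar shift_shift add.commute)
      then show ?thesis
        using wvar_plus_zvar_nonzero[of i, where 'k = 'k] by simp
    qed
    \<comment> \<open>Evaluating at w + x raises m - 1 to m: the denominator in the recursion for
      \<open>G m\<close> becomes the factor w + (n - 1)x = w + mx from the recursion for
      \<open>F m n\<close>.\<close>
    have denom: "shift xc (wvar + of_nat (m - 1) * xvar) = (wvar + of_nat m * xvar :: 'k ratfun)"
      using m by (cases m) (simp_all add: shift_add shift_mult shift_1 shift_of_nat shift_xvar
          shift_xc_wvar distrib_right add.assoc)
    have "shift xc (G m) = shift xc (\<Sum>k = 1..m - 1.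
        G k * shift (of_nat k * zc) (G (m - k)) / (wvar + of_nat (m - 1) * xvar) :: 'k ratfun)"
      using m by (subst G.simps) simp
    also have "\<dots> = (\<Sum>k = 1..m - 1. shift xc (G k) * shift xc (shift (of_nat k * zc) (G (m - k))))
        / (wvar + of_nat m * xvar)"
      by (simp only: shift_sum shift_divide shift_mult denom sum_divide_distrib)
    finally have Gm: "shift xc (G m) / (wvar * (wvar + of_nat m * zvar)) =
        (\<Sum>k = 1..m - 1. shift xc (G k) * shift xc (shift (of_nat k * zc) (G (m - k)))) / ?d"
      by (simp add: mult_ac)
    have "F m n = (\<Sum>i = 1..m - 1.
        (wvar + of_nat i * zvar) * shift xc (G i) * shift (of_nat i * zc) (F (m - i) (n - i))
          / (wvar * (wvar + of_nat m * xvar)) :: 'k ratfun)"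
      using m n by (subst F.simps) simp
    also have "\<dots> = (\<Sum>i = 1..m - 1.
        shift xc (G i) * shift xc (shift (of_nat i * zc) (G (m - i))) / ?d)"
      by (rule sum.cong) (simp_all only: summand)
    finally show ?thesis
      using Gm n by (simp add: sum_divide_distrib)
  qed
qed

end
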